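(* Let $\{W_n\}_{n\in\mathbb N}$ be any sequence of metric spaces with $\operatorname{diam}(W_n)=1$ for all $n$. Let $a=\{a_n\},b=\{b_n\}\in l^1_+$ be such that $a_n\le b_n$ for every $n\in\mathbb N$. Then $$2d_{GH}\Bigl((l^1)\prod_{n=1}^\infty a_nW_n,\ (l^1)\prod_{n=1}^\infty b_nW_n\Bigr)=\sum_{n=1}^\infty(b_n-a_n).$$
   Context: $l^1_+$ is the set of summable sequences of nonnegative real numbers. $\operatorname{diam}(X)=\sup_{x,y\in X}d_X(x,y)$. A correspondence between $X$ and $Y$ is a subset $R\subset X\times Y$ whose projections to $X$ and to $Y$ are surjective; its distortion is $\operatorname{dis}R=\sup\{|d_X(x,x')-d_Y(y,y')| : (x,y),(x',y')\in R\}$. The Gromov--Hausdorff distance is $d_{GH}(X,Y)=\frac12\inf\{\operatorname{dis}R: R\text{ a correspondence between }X\text{ and }Y\}$. For a metric space $W=(W,d)$ and $\lambda>0$, $\lambda W$ is the space $(W,\lambda d)$. For $\lambda=0$, $0\cdot W$ denotes the set $W$ with the zero pseudometric (equivalently, for the purpose of $d_{GH}$, a one-point space). The $l^1$-product $(l^1)\prod_nX_n$ of spaces $(X_n,d_n)$ with $\sum_n\operatorname{diam}(X_n)<\infty$ is the Cartesian product with distance $d(\{x_n\},\{y_n\})=\sum_nd_n(x_n,y_n)$. *)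

theory Defs
  imports "HOL-Analysis.Analysis"
begin

(* A carrier set with a distance function. Scaling by 0 produces pseudometrics, so the
   library type of genuine metrics cannot carry all the spaces that occur; the notions below
   make sense for pseudometric (in particular metric) spaces. Distances outside the carrier
   are irrelevant. *)
type_synonym 'a dspace = "'a set \<times> ('a \<Rightarrow> 'a \<Rightarrow> real)"

definition dspace_of :: "'a metric \<Rightarrow> 'a dspace" where
  "dspace_of W = (mspace W, mdist W)"

(* Extended-valued, so that an unbounded space has diameter top. *)
definition diam :: "'a dspace \<Rightarrow> ennreal" where
  "diam X = (SUP (x, y) \<in> fst X \<times> fst X. ennreal (snd X x y))"

definition rescale :: "real \<Rightarrow> 'a dspace \<Rightarrow> 'a dspace" where
  "rescale c X = (fst X, \<lambda>x y. c * snd X x y)"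

definition l1_plus :: "(nat \<Rightarrow> real) set" where
  "l1_plus = {a. (\<forall>n. 0 \<le> a n) \<and> summable a}"

(* Meant for sequences of spaces whose diameters have a finite sum; then the series
   of distances converges on the carrier. *)
definition l1_prod :: "(nat \<Rightarrow> 'a dspace) \<Rightarrow> (nat \<Rightarrow> 'a) dspace" where
  "l1_prod X = (PiE UNIV (\<lambda>n. fst (X n)), \<lambda>x y. \<Sum>n. snd (X n) (x n) (y n))"

definition correspondences :: "'a dspace \<Rightarrow> 'b dspace \<Rightarrow> ('a \<times> 'b) set set" where
  "correspondences X Y = {R. R \<subseteq> fst X \<times> fst Y \<and> fst ` R = fst X \<and> snd ` R = fst Y}"

definition distortion :: "'a dspace \<Rightarrow> 'b dspace \<Rightarrow> ('a \<times> 'b) set \<Rightarrow> ennreal" where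
  "distortion X Y R =
     (SUP ((x, y), (x', y')) \<in> R \<times> R. ennreal \<bar>snd X x x' - snd Y y y'\<bar>)"

definition gh_dist :: "'a dspace \<Rightarrow> 'b dspace \<Rightarrow> ennreal" where
  "gh_dist X Y = (INF R \<in> correspondences X Y. distortion X Y R) / 2"

end

theory Submission
  imports Defs
begin

text \<open>Two bounds meet. For the lower bound, a correspondence matches any pair of points of one space
  with a pair of points of the other, and the two distances differ by at most the distortion; hence
  the diameters of two spaces differ by at most twice their Gromov--Hausdorff distance
  (\<open>diam_le_diam_plus_gh_dist\<close>). Choosing nearly diametral pairs in all factors simultaneously
  shows that diameters add up in \<open>l\<^sup>1\<close>-products (\<open>diam_l1_prod_rescale\<close>), so the
  diameters of the two products are \<open>\<Sum>n. a n\<close> and \<open>\<Sum>n. b n\<close>.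

  For the upper bound, both products have the same underlying set, and the diagonal is a
  correspondence. Its distortion is at most the total change of the scaling factors, because every
  distance in every factor is at most 1 (\<open>gh_dist_l1_prod_rescale_le\<close>). As \<open>a n \<le> b n\<close> for
  all \<open>n\<close>, that total change is exactly the difference of the two diameters.\<close>

lemma diam_le_diam_plus_distortion:
  assumes "R \<in> correspondences X Y"
  shows "diam Y \<le> diam X + distortion X Y R"
  unfolding diam_def[of Y]
proof (rule SUP_least, clarify)
  fix y y' assume "y \<in> fst Y" "y' \<in> fst Y"
  with assms have "y \<in> snd ` R" "y' \<in> snd ` R"
    by (simp_all add: correspondences_def)
  then obtain x x' where R: "(x, y) \<in> R" "(x', y') \<in> R"
    by auto
  with assms have X: "x \<in> fst X" "x' \<in> fst X"
    by (auto simp: correspondences_def)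
  (* Clipping at 0 because distance functions are not required to be nonnegative. *)
  have "ennreal (snd Y y y') \<le> ennreal (max 0 (snd X x x') + \<bar>snd X x x' - snd Y y y'\<bar>)"
    by (rule ennreal_leI) linarith
  also have "\<dots> = ennreal (snd X x x') + ennreal \<bar>snd X x x' - snd Y y y'\<bar>"
    by (simp add: ennreal_plus ennreal_max_0)
  also have "\<dots> \<le> diam X + distortion X Y R"
  proof (rule add_mono)
    show "ennreal (snd X x x') \<le> diam X"
      unfolding diam_def using X by (intro SUP_upper2[of "(x, x')"]) auto
    show "ennreal \<bar>snd X x x' - snd Y y y'\<bar> \<le> distortion X Y R"
      unfolding distortion_def using R by (intro SUP_upper2[of "((x, y), (x', y'))"]) auto
  qed
  finally show "ennreal (snd Y y y') \<le> diam X + distortion X Y R" .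
qed

lemma twice_gh_dist:
  "2 * gh_dist X Y = (INF R \<in> correspondences X Y. distortion X Y R)"
  by (simp add: gh_dist_def ennreal_times_divide mult.commute[of 2] mult_divide_eq_ennreal)

lemma diam_le_diam_plus_gh_dist:
  "diam Y \<le> diam X + 2 * gh_dist X Y"
proof (cases "diam X = top")
  case False
  have "diam Y - diam X \<le> 2 * gh_dist X Y"
    unfolding twice_gh_dist
    using diam_le_diam_plus_distortion[of _ X Y] False
    by (intro INF_greatest) (simp add: ennreal_minus_le_iff)
  then show ?thesis
    using False by (simp add: ennreal_minus_le_iff)
qed simp

lemma mdist_le_1:
  assumes "diam (dspace_of M) = 1" "x \<in> mspace M" "y \<in> mspace M"
  shows "mdist M x y \<le> 1"
proof -
  have "ennreal (mdist M x y) \<le> diam (dspace_of M)"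
    unfolding diam_def dspace_of_def using assms(2,3) by (intro SUP_upper2[of "(x, y)"]) auto
  with assms(1) show ?thesis by simp
qed

lemma nearly_diametral_pair:
  assumes "diam (dspace_of M) = 1" "t < 1"
  obtains x y where "x \<in> mspace M" "y \<in> mspace M" "t < mdist M x y"
proof -
  have "ennreal t < diam (dspace_of M)"
    using assms by simp
  then obtain x y where "x \<in> mspace M" "y \<in> mspace M" "ennreal t < ennreal (mdist M x y)"
    unfolding diam_def dspace_of_def less_SUP_iff by auto
  then show ?thesis
    using that[of x y] ennreal_leI[of "mdist M x y" t] by (auto simp flip: not_le)
qed

lemma l1_prod_rescale:
  "l1_prod (\<lambda>n. rescale (c n) (dspace_of (W n))) =
     (PiE UNIV (\<lambda>n. mspace (W n)), \<lambda>x y. \<Sum>n. c n * mdist (W n) (x n) (y n))"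
  by (simp add: l1_prod_def rescale_def dspace_of_def)

lemma summable_mult_mdist:
  assumes "\<And>n. diam (dspace_of (W n)) = 1" "c \<in> l1_plus"
    and "x \<in> PiE UNIV (\<lambda>n. mspace (W n))" "y \<in> PiE UNIV (\<lambda>n. mspace (W n))"
  shows "summable (\<lambda>n. c n * mdist (W n) (x n) (y n))"
proof (rule summable_comparison_test')
  show "summable c" using assms(2) by (simp add: l1_plus_def)
  show "norm (c n * mdist (W n) (x n) (y n)) \<le> c n" for n
    using assms mdist_le_1[of "W n" "x n" "y n"]
    by (auto simp: l1_plus_def abs_mult intro!: mult_left_le)
qed

text \<open>The supremum need not be attained, as the factors need not have diametral pairs. But pairs at
  distance greater than \<open>t < 1\<close> exist in each factor, and using the same \<open>t\<close> for all of
  them costs only the factor \<open>t\<close> in the sum.\<close>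
lemma diam_l1_prod_rescale:
  assumes W: "\<And>n. diam (dspace_of (W n)) = 1" and c: "c \<in> l1_plus"
  shows "diam (l1_prod (\<lambda>n. rescale (c n) (dspace_of (W n)))) = ennreal (\<Sum>n. c n)"
    (is "diam ?P = _")
proof (rule antisym)
  have sc: "summable c" and c0: "\<And>n. 0 \<le> c n"
    using c by (auto simp: l1_plus_def)
  show "diam ?P \<le> ennreal (\<Sum>n. c n)"
    unfolding diam_def l1_prod_rescale
  proof (rule SUP_least, clarsimp)
    fix x y assume xy: "x \<in> PiE UNIV (\<lambda>n. mspace (W n))" "y \<in> PiE UNIV (\<lambda>n. mspace (W n))"
    show "ennreal (\<Sum>n. c n * mdist (W n) (x n) (y n)) \<le> ennreal (\<Sum>n. c n)"
      using xy c0 mdist_le_1[OF W]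
      by (intro ennreal_leI suminf_le summable_mult_mdist W c xy sc mult_left_le)
         (auto simp: PiE_iff)
  qed
  have near: "ennreal (t * (\<Sum>n. c n)) \<le> diam ?P" if t: "t < 1" for t
  proof -
    have "\<exists>x y. x \<in> mspace (W n) \<and> y \<in> mspace (W n) \<and> t < mdist (W n) x y" for n
      using nearly_diametral_pair[OF W t] by metis
    then obtain x y where xy: "\<And>n. x n \<in> mspace (W n)" "\<And>n. y n \<in> mspace (W n)"
      and far: "\<And>n. t < mdist (W n) (x n) (y n)"
      by metis
    have P: "x \<in> PiE UNIV (\<lambda>n. mspace (W n))" "y \<in> PiE UNIV (\<lambda>n. mspace (W n))"
      using xy by auto
    have "t * (\<Sum>n. c n) = (\<Sum>n. c n * t)"
      using suminf_mult[OF sc, of t] by (simp add: mult.commute)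
    also have "\<dots> \<le> (\<Sum>n. c n * mdist (W n) (x n) (y n))"
      using far c0 sc
      by (intro suminf_le summable_mult_mdist W c P summable_mult2 mult_left_mono)
         (auto intro: less_imp_le)
    finally show ?thesis
      unfolding diam_def l1_prod_rescale using P
      by (intro SUP_upper2[of "(x, y)"]) (auto intro: ennreal_leI)
  qed
  have "((\<lambda>t. ennreal (t * (\<Sum>n. c n))) \<longlongrightarrow> ennreal (1 * (\<Sum>n. c n))) (at_left 1)"
    by (intro tendsto_intros)
  then have "ennreal (1 * (\<Sum>n. c n)) \<le> diam ?P"
    using near by (intro tendsto_upperbound) (auto simp: eventually_at_filter)
  then show "ennreal (\<Sum>n. c n) \<le> diam ?P" by simp
qed

lemma gh_dist_l1_prod_rescale_le:
  assumes W: "\<And>n. diam (dspace_of (W n)) = 1" and a: "a \<in> l1_plus" and b: "b \<in> l1_plus"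
  shows "2 * gh_dist (l1_prod (\<lambda>n. rescale (a n) (dspace_of (W n))))
                     (l1_prod (\<lambda>n. rescale (b n) (dspace_of (W n))))
         \<le> ennreal (\<Sum>n. \<bar>b n - a n\<bar>)"
    (is "2 * gh_dist ?A ?B \<le> _")
proof -
  let ?P = "PiE UNIV (\<lambda>n. mspace (W n))"
  have sab: "summable (\<lambda>n. \<bar>b n - a n\<bar>)"
  proof (rule summable_comparison_test')
    show "summable (\<lambda>n. b n + a n)"
      using a b by (intro summable_add) (auto simp: l1_plus_def)
    show "norm \<bar>b n - a n\<bar> \<le> b n + a n" for n
      using a b by (simp add: l1_plus_def abs_le_iff)
  qed
  have "Id_on ?P \<in> correspondences ?A ?B"
    unfolding l1_prod_rescale correspondences_def by (force simp: Id_on_def)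
  then have "2 * gh_dist ?A ?B \<le> distortion ?A ?B (Id_on ?P)"
    unfolding twice_gh_dist by (rule INF_lower)
  also have "\<dots> \<le> ennreal (\<Sum>n. \<bar>b n - a n\<bar>)"
    unfolding distortion_def l1_prod_rescale
  proof (rule SUP_least, clarsimp simp del: PiE_UNIV_domain elim!: Id_onE)
    fix x y assume xy: "x \<in> ?P" "y \<in> ?P"
    let ?d = "\<lambda>n. mdist (W n) (x n) (y n)"
    have le: "norm (a n * ?d n - b n * ?d n) \<le> \<bar>b n - a n\<bar>" for n
    proof -
      have "norm (a n * ?d n - b n * ?d n) = \<bar>b n - a n\<bar> * ?d n"
        by (simp add: abs_mult abs_minus_commute flip: left_diff_distrib)
      also have "\<dots> \<le> \<bar>b n - a n\<bar>"
        using xy by (intro mult_left_le mdist_le_1 W) auto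
      finally show ?thesis .
    qed
    have "\<bar>(\<Sum>n. a n * ?d n) - (\<Sum>n. b n * ?d n)\<bar> = norm (\<Sum>n. a n * ?d n - b n * ?d n)"
      by (simp add: suminf_diff summable_mult_mdist W a b xy)
    also have "\<dots> \<le> (\<Sum>n. \<bar>b n - a n\<bar>)"
      by (rule norm_suminf_le[OF le sab])
    finally show "ennreal \<bar>(\<Sum>n. a n * ?d n) - (\<Sum>n. b n * ?d n)\<bar> \<le> ennreal (\<Sum>n. \<bar>b n - a n\<bar>)"
      by (rule ennreal_leI)
  qed
  finally show ?thesis .
qed

theorem corollary3p13:
  fixes W :: "nat \<Rightarrow> 'a metric" and a b :: "nat \<Rightarrow> real"
  assumes "\<And>n. diam (dspace_of (W n)) = 1"
    and "a \<in> l1_plus" and "b \<in> l1_plus"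
    and "\<And>n. a n \<le> b n"
  shows "2 * gh_dist (l1_prod (\<lambda>n. rescale (a n) (dspace_of (W n))))
                     (l1_prod (\<lambda>n. rescale (b n) (dspace_of (W n))))
         = ennreal (\<Sum>n. b n - a n)"
    (is "2 * gh_dist ?A ?B = _")
proof (rule antisym)
  show "2 * gh_dist ?A ?B \<le> ennreal (\<Sum>n. b n - a n)"
    using gh_dist_l1_prod_rescale_le[OF assms(1-3)] assms(4) by simp
  have "0 \<le> (\<Sum>n. a n)" and sub: "(\<Sum>n. b n - a n) = (\<Sum>n. b n) - (\<Sum>n. a n)"
    using assms(2,3) by (auto simp: l1_plus_def suminf_nonneg suminf_diff)
  then have "ennreal (\<Sum>n. b n - a n) = diam ?B - diam ?A"
    by (simp add: diam_l1_prod_rescale[OF assms(1,2)] diam_l1_prod_rescale[OF assms(1,3)]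
        ennreal_minus)
  also have "\<dots> \<le> 2 * gh_dist ?A ?B"
    using diam_le_diam_plus_gh_dist[of ?B ?A]
    by (simp add: diam_l1_prod_rescale[OF assms(1,2)] ennreal_minus_le_iff)
  finally show "ennreal (\<Sum>n. b n - a n) \<le> 2 * gh_dist ?A ?B" .
qed

end
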